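(* Fix an integer $k\ge 3$ and $\epsilon>0$. For $n$ divisible by $3$, consider the family of graphs $\mathsf{G}_k^{\mu,\upsilon}(\mathbf{X})$ (defined in the context) over all $\mathbf{X}\in\{0,1\}^{n/3\times n/3}$ and $\mu,\upsilon\in\{0,1\}^{n/3}$, each having $\mathsf{n}=kn/3$ nodes. There exists no non-interactive $\epsilon$-edge locally differentially private algorithm that estimates the number of $k$-cliques $K_k$ in every graph $\mathsf{G}_k^{\mu,\upsilon}(\mathbf{X})$ with expected $\ell_2$-error $o(\mathsf{n}^{k-1})$ (as $n\to\infty$, uniformly over $\mathbf{X},\mu,\upsilon$).
   Context: Graph $\mathsf{G}_k^{\mu,\upsilon}(\mathbf{X})$: the vertex set is the disjoint union of $k$ sets $\mathsf{U}=\{\mathsf{u}_1,\dots,\mathsf{u}_{n/3}\}$, $\mathsf{Y}=\{\mathsf{y}_1,\dots,\mathsf{y}_{n/3}\}$, and $\mathsf{W}_p=\{\mathsf{w}_{p,1},\dots,\mathsf{w}_{p,n/3}\}$ for $1\le p\le k-2$. Its edges are exactly: $\{\mathsf{u}_i,\mathsf{y}_j\}$ iff $\mathbf{X}_{i,j}=1$; $\{\mathsf{u}_i,\mathsf{w}_{p,j}\}$ for all $p,j$ iff $\mu_i=1$; $\{\mathsf{y}_i,\mathsf{w}_{p,j}\}$ for all $p,j$ iff $\upsilon_i=1$; and $\{\mathsf{w}_{p,i},\mathsf{w}_{q,j}\}$ for all $i,j$ and all $p\ne q$. There are no other edges. Each node (user) knows only its own adjacency vector (a 0-1 vector indicating its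 neighbors). Two adjacency vectors are neighboring if they differ in exactly one bit. A randomized mechanism $\mathcal{R}$ is $\epsilon$-edge locally differentially private if for all neighboring $a,a'$ and all measurable $S$, $\Pr[\mathcal{R}(a)\in S]\le e^{\epsilon}\Pr[\mathcal{R}(a')\in S]$. A non-interactive $\epsilon$-edge locally differentially private algorithm is one in which each node $v$ applies, once, an $\epsilon$-edge locally differentially private randomizer $\mathcal{L}_v$ to its adjacency vector (independently of other users' responses) and sends $\mathcal{L}_v(a_v)$ to a server, which outputs an aggregate function of all the reports. The expected $\ell_2$-error of an estimate $\tilde K$ of a true value $K$ is $\sqrt{\mathbb{E}[(\tilde K - K)^2]}$. *)

theory Defs
  imports "HOL-Probability.Probability"
begin

datatype vtx = U nat | Y nat | W nat nat

definition vertices :: "nat \<Rightarrow> nat \<Rightarrow> vtx set" where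
  "vertices k n = {U i | i. i < n div 3} \<union> {Y i | i. i < n div 3}
      \<union> {W p i | p i. p < k - 2 \<and> i < n div 3}"

fun adj :: "(nat \<Rightarrow> nat \<Rightarrow> bool) \<Rightarrow> (nat \<Rightarrow> bool) \<Rightarrow> (nat \<Rightarrow> bool) \<Rightarrow> vtx \<Rightarrow> vtx \<Rightarrow> bool" where
  "adj X mu up (U i) (Y j) = X i j"
| "adj X mu up (Y j) (U i) = X i j"
| "adj X mu up (U i) (W p j) = mu i"
| "adj X mu up (W p j) (U i) = mu i"
| "adj X mu up (Y i) (W p j) = up i"
| "adj X mu up (W p j) (Y i) = up i"
| "adj X mu up (W p i) (W q j) = (p \<noteq> q)"
| "adj X mu up _ _ = False"

text \<open>Adjacency vector of node v (as the set of its neighbours within the vertex set).\<close>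
definition nbrs :: "nat \<Rightarrow> nat \<Rightarrow> (nat \<Rightarrow> nat \<Rightarrow> bool) \<Rightarrow> (nat \<Rightarrow> bool) \<Rightarrow> (nat \<Rightarrow> bool) \<Rightarrow> vtx \<Rightarrow> vtx set" where
  "nbrs k n X mu up v = {w \<in> vertices k n. adj X mu up v w}"

definition num_cliques :: "nat \<Rightarrow> nat \<Rightarrow> (nat \<Rightarrow> nat \<Rightarrow> bool) \<Rightarrow> (nat \<Rightarrow> bool) \<Rightarrow> (nat \<Rightarrow> bool) \<Rightarrow> nat" where
  "num_cliques k n X mu up =
     card {S. S \<subseteq> vertices k n \<and> card S = k \<and> (\<forall>a\<in>S. \<forall>b\<in>S. a \<noteq> b \<longrightarrow> adj X mu up a b)}"

text \<open>epsilon-edge LDP randomizer on adjacency vectors (0-1 vectors indexed by the vertex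
  set V, represented as subsets of V); outputs are probability measures on the output space Mo.
  Neighbouring vectors differ in exactly one bit.\<close>
definition edge_ldp :: "real \<Rightarrow> 'v set \<Rightarrow> 'o measure \<Rightarrow> ('v set \<Rightarrow> 'o measure) \<Rightarrow> bool" where
  "edge_ldp eps V Mo R \<longleftrightarrow>
     (\<forall>a. a \<subseteq> V \<longrightarrow> prob_space (R a) \<and> sets (R a) = sets Mo) \<and>
     (\<forall>a a'. a \<subseteq> V \<longrightarrow> a' \<subseteq> V \<longrightarrow> card (sym_diff a a') = 1 \<longrightarrow>
        (\<forall>S \<in> sets Mo. measure (R a) S \<le> exp eps * measure (R a') S))"

text \<open>Mean squared error of the non-interactive protocol: node v independently sends
  R v (its adjacency vector), the server outputs f of all reports.\<close>
definition mse :: "nat \<Rightarrow> nat \<Rightarrow> (vtx \<Rightarrow> vtx set \<Rightarrow> 'o measure) \<Rightarrow> ((vtx \<Rightarrow> 'o) \<Rightarrow> real)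
    \<Rightarrow> (nat \<Rightarrow> nat \<Rightarrow> bool) \<Rightarrow> (nat \<Rightarrow> bool) \<Rightarrow> (nat \<Rightarrow> bool) \<Rightarrow> ennreal" where
  "mse k n R f X mu up =
     (\<integral>\<^sup>+ r. ennreal ((f r - real (num_cliques k n X mu up))\<^sup>2)
        \<partial>(PiM (vertices k n) (\<lambda>v. R v (nbrs k n X mu up v))))"

end

theory Submission
  imports Defs
begin

text \<open>A k-clique is a transversal of the k parts, so the number of k-cliques is (n/3)^(k-2) times the
  cut query that sums X(i,j) over i in A and j in B, where A and B are the supports of mu and
  upsilon. An error o(n^(k-1)) thus answers all 4^(n/3) cut queries with error o(n), and
  because the protocol is non-interactive, all queries can be answered from one joint
  sample in which each node of U and Y reports only twice. Bessel's inequality for the characters of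
  (A, B) turns these answers into estimates of the entries of X with mean squared error o(1) on
  average. But the joint sample is 4 epsilon-private in each entry, which forces a constant error
  for an average entry of an average matrix.\<close>

section \<open>Domination of product measures with multiplicative constants\<close>

lemma nn_integral_le_scaled:
  assumes sets: "sets N = sets M"
    and le: "\<And>A. A \<in> sets M \<Longrightarrow> emeasure M A \<le> K * emeasure N A"
    and g: "g \<in> borel_measurable M"
  shows "nn_integral M g \<le> K * nn_integral N g"
proof -
  have "nn_integral M g \<le> nn_integral (scale_measure K N) g"
  proof (rule nn_integral_mono_measure)
    show "M \<le> scale_measure K N"
      using sets le by (subst le_measure) auto
  qed (use sets in auto)
  also have "\<dots> = K * nn_integral N g"
    using g by (subst nn_integral_scale_measure) (simp_all cong: measurable_cong_sets add: sets)
  finally show ?thesis .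
qed

text \<open>The factors are replaced one coordinate at a time: Fubini isolates coordinate
  \<open>i\<close>, the one-dimensional bound replaces \<open>M i\<close> by \<open>N i\<close>, and
  the induction hypothesis treats the rest. Separate constants \<open>K i\<close> let coordinates
  with identical factors contribute 1.\<close>

lemma nn_integral_PiM_le_scaled:
  fixes K :: "'i \<Rightarrow> ennreal"
  assumes I: "finite I"
    and M: "\<And>i. prob_space (M i)" and N: "\<And>i. prob_space (N i)"
    and sets: "\<And>i. i \<in> I \<Longrightarrow> sets (N i) = sets (M i)"
    and le: "\<And>i A. i \<in> I \<Longrightarrow> A \<in> sets (M i) \<Longrightarrow> emeasure (M i) A \<le> K i * emeasure (N i) A"
    and phi: "\<phi> \<in> borel_measurable (PiM I M)"
  shows "nn_integral (PiM I M) \<phi> \<le> (\<Prod>i\<in>I. K i) * nn_integral (PiM I N) \<phi>"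
  using I sets le phi
proof (induction I arbitrary: \<phi> rule: finite_induct)
  case empty
  show ?case by (simp add: PiM_empty)
next
  case (insert i I)
  interpret M: product_sigma_finite M
    using M by (simp add: product_sigma_finite_def prob_space_imp_sigma_finite)
  interpret N: product_sigma_finite N
    using N by (simp add: product_sigma_finite_def prob_space_imp_sigma_finite)
  note [measurable] = insert.prems(3)
  have setsPi: "sets (PiM (insert i I) N) = sets (PiM (insert i I) M)"
    using insert.prems(1) by (intro sets_PiM_cong) auto
  have phiN: "\<phi> \<in> borel_measurable (PiM (insert i I) N)"
    using insert.prems(3) setsPi by (simp cong: measurable_cong_sets)
  \<comment> \<open>The hybrid stage: coordinate \<open>i\<close> already follows \<open>N\<close>,
    the other coordinates still follow \<open>M\<close>.\<close>
  have meas: "(\<lambda>x. \<integral>\<^sup>+ y. \<phi> (x(i := y)) \<partial>N i) \<in> borel_measurable (PiM I M)"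
  proof (rule sigma_finite_measure.borel_measurable_nn_integral[OF N[THEN prob_space_imp_sigma_finite]])
    have "(\<lambda>(x, y). x(i := y)) \<in> measurable (PiM I M \<Otimes>\<^sub>M M i) (PiM (insert i I) M)"
      by (rule measurable_add_dim)
    then have "(\<lambda>(x, y). \<phi> (x(i := y))) \<in> borel_measurable (PiM I M \<Otimes>\<^sub>M M i)"
      by measurable
    moreover have "sets (PiM I M \<Otimes>\<^sub>M M i) = sets (PiM I M \<Otimes>\<^sub>M N i)"
      using insert.prems(1) by (intro sets_pair_measure_cong) auto
    ultimately show "(\<lambda>(x, y). \<phi> (x(i := y))) \<in> borel_measurable (PiM I M \<Otimes>\<^sub>M N i)"
      by (simp cong: measurable_cong_sets)
  qed
  have "nn_integral (PiM (insert i I) M) \<phi>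
      = (\<integral>\<^sup>+ x. (\<integral>\<^sup>+ y. \<phi> (x(i := y)) \<partial>M i) \<partial>PiM I M)"
    using insert by (intro M.product_nn_integral_insert) auto
  also have "\<dots> \<le> (\<integral>\<^sup>+ x. K i * (\<integral>\<^sup>+ y. \<phi> (x(i := y)) \<partial>N i) \<partial>PiM I M)"
  proof (intro nn_integral_mono nn_integral_le_scaled)
    fix x assume "x \<in> space (PiM I M)"
    then have "(\<lambda>y. x(i := y)) \<in> measurable (M i) (PiM (insert i I) M)"
      using insert.hyps by (intro measurable_component_update) auto
    then show "(\<lambda>y. \<phi> (x(i := y))) \<in> borel_measurable (M i)" by measurable
  qed (use insert.prems in auto)
  also have "\<dots> = K i * (\<integral>\<^sup>+ x. (\<integral>\<^sup>+ y. \<phi> (x(i := y)) \<partial>N i) \<partial>PiM I M)"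
    using meas by (rule nn_integral_cmult)
  also have "\<dots> \<le> K i * ((\<Prod>i\<in>I. K i) * (\<integral>\<^sup>+ x. (\<integral>\<^sup>+ y. \<phi> (x(i := y)) \<partial>N i) \<partial>PiM I N))"
    by (intro mult_left_mono insert.IH meas) (use insert.prems in auto)
  also have "(\<integral>\<^sup>+ x. (\<integral>\<^sup>+ y. \<phi> (x(i := y)) \<partial>N i) \<partial>PiM I N) = nn_integral (PiM (insert i I) N) \<phi>"
    using insert phiN by (intro N.product_nn_integral_insert[symmetric]) auto
  finally show ?case
    using insert.hyps by (simp add: mult.assoc)
qed

section \<open>Fourier analysis of cut queries\<close>

lemma bij_betw_flip:
  assumes "i \<in> S"
  shows "bij_betw (\<lambda>A. sym_diff A {i}) (Pow S) (Pow S)"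
  by (rule bij_betw_byWitness[where f' = "\<lambda>A. sym_diff A {i}"]) (use assms in auto)

text \<open>Up to sign, the degree-one Walsh character of coordinate \<open>i\<close> on the cube of
  subsets.\<close>

definition chi :: "'a \<Rightarrow> 'a set \<Rightarrow> real" where
  "chi i A = (if i \<in> A then 1 else - 1)"

lemma chi_square [simp]: "chi i A * chi i A = 1"
  by (simp add: chi_def)

lemma sum_chi:
  assumes "i \<in> S"
  shows "(\<Sum>A\<in>Pow S. chi i A) = 0"
proof -
  have "(\<Sum>A\<in>Pow S. chi i A) = (\<Sum>A\<in>Pow S. chi i (sym_diff A {i}))"
    using sum.reindex_bij_betw[OF bij_betw_flip[OF assms], of "chi i"] by simp
  also have "\<dots> = (\<Sum>A\<in>Pow S. - chi i A)"
    by (intro sum.cong) (auto simp: chi_def)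
  finally show ?thesis by (simp add: sum_negf)
qed

text \<open>For distinct \<open>i\<close> and \<open>j\<close>, flipping the membership of
  \<open>i\<close> negates \<open>chi i\<close> and fixes \<open>chi j\<close>, so the sum equals
  its own negative.\<close>

lemma sum_chi_mult:
  assumes "finite S" "i \<in> S" "j \<in> S"
  shows "(\<Sum>A\<in>Pow S. chi i A * chi j A) = (if i = j then 2 ^ card S else 0)"
proof (cases "i = j")
  case True
  then show ?thesis using assms by (simp add: card_Pow)
next
  case False
  have "(\<Sum>A\<in>Pow S. chi i A * chi j A)
      = (\<Sum>A\<in>Pow S. chi i (sym_diff A {i}) * chi j (sym_diff A {i}))"
    using sum.reindex_bij_betw[OF bij_betw_flip[OF assms(2)], of "\<lambda>A. chi i A * chi j A"] by simp
  also have "\<dots> = (\<Sum>A\<in>Pow S. - (chi i A * chi j A))"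
    using False by (intro sum.cong) (auto simp: chi_def)
  finally show ?thesis using False by (simp add: sum_negf)
qed

text \<open>The indicator of \<open>j \<in> A\<close> is \<open>(1 + chi j A) / 2\<close>, and the
  constant part is orthogonal to \<open>chi i\<close>.\<close>

lemma sum_chi_of_bool:
  assumes "finite S" "i \<in> S" "j \<in> S"
  shows "2 * (\<Sum>A\<in>Pow S. chi i A * of_bool (j \<in> A)) = (if i = j then 2 ^ card S else 0)"
proof -
  have "2 * (\<Sum>A\<in>Pow S. chi i A * of_bool (j \<in> A)) = (\<Sum>A\<in>Pow S. chi i A + chi i A * chi j A)"
    unfolding sum_distrib_left by (intro sum.cong) (auto simp: chi_def)
  then show ?thesis
    using assms by (simp add: sum.distrib sum_chi sum_chi_mult)
qed

text \<open>Bessel's inequality for an orthogonal family whose members all have squared norm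
  \<open>N\<close>. It follows from expanding the squared norm of \<open>N h - p\<close>.\<close>

lemma bessel_finite:
  fixes h :: "'w \<Rightarrow> real" and e :: "'i \<Rightarrow> 'w \<Rightarrow> real"
  assumes "finite I" "N > 0"
    and orth: "\<And>i j. i \<in> I \<Longrightarrow> j \<in> I \<Longrightarrow> (\<Sum>w\<in>\<Omega>. e i w * e j w) = (if i = j then N else 0)"
  shows "(\<Sum>i\<in>I. (\<Sum>w\<in>\<Omega>. e i w * h w)\<^sup>2) \<le> N * (\<Sum>w\<in>\<Omega>. (h w)\<^sup>2)"
proof -
  define a where "a i = (\<Sum>w\<in>\<Omega>. e i w * h w)" for i
  \<comment> \<open>This is \<open>N\<close> times the orthogonal projection of \<open>h\<close>
    onto the span of the \<open>e i\<close>.\<close>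
  define p where "p w = (\<Sum>i\<in>I. a i * e i w)" for w
  have ph: "(\<Sum>w\<in>\<Omega>. p w * h w) = (\<Sum>i\<in>I. (a i)\<^sup>2)"
    unfolding p_def sum_distrib_right
    by (subst sum.swap) (simp add: a_def power2_eq_square sum_distrib_left mult.assoc)
  have "(\<Sum>w\<in>\<Omega>. p w * p w) = (\<Sum>w\<in>\<Omega>. \<Sum>i\<in>I. \<Sum>j\<in>I. a i * a j * (e i w * e j w))"
    unfolding p_def sum_product by (intro sum.cong) auto
  also have "\<dots> = (\<Sum>i\<in>I. \<Sum>j\<in>I. a i * a j * (\<Sum>w\<in>\<Omega>. e i w * e j w))"
    unfolding sum_distrib_left by (subst sum.swap, intro sum.cong refl sum.swap)
  also have "\<dots> = (\<Sum>i\<in>I. \<Sum>j\<in>I. if i = j then N * (a i)\<^sup>2 else 0)"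
    by (intro sum.cong refl) (simp add: orth power2_eq_square)
  also have "\<dots> = N * (\<Sum>i\<in>I. (a i)\<^sup>2)"
    using assms(1) by (simp add: sum_distrib_left)
  finally have pp: "(\<Sum>w\<in>\<Omega>. p w * p w) = N * (\<Sum>i\<in>I. (a i)\<^sup>2)" .
  have "0 \<le> (\<Sum>w\<in>\<Omega>. (N * h w - p w)\<^sup>2)"
    by (intro sum_nonneg) auto
  also have "\<dots> = (\<Sum>w\<in>\<Omega>. N\<^sup>2 * (h w)\<^sup>2 + p w * p w - 2 * N * (p w * h w))"
    by (intro sum.cong) (auto simp: power2_eq_square algebra_simps)
  also have "\<dots> = N\<^sup>2 * (\<Sum>w\<in>\<Omega>. (h w)\<^sup>2) + (\<Sum>w\<in>\<Omega>. p w * p w) - 2 * N * (\<Sum>w\<in>\<Omega>. p w * h w)"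
    by (simp add: sum.distrib sum_subtractf sum_distrib_left)
  also have "\<dots> = N * (N * (\<Sum>w\<in>\<Omega>. (h w)\<^sup>2) - (\<Sum>i\<in>I. (a i)\<^sup>2))"
    unfolding pp ph by (simp add: power2_eq_square algebra_simps)
  finally show ?thesis
    using \<open>N > 0\<close> by (simp add: a_def zero_le_mult_iff)
qed

text \<open>An estimate of all cut queries yields an estimate of the entries of the matrix, namely
  the Fourier coefficients of the answers at the products of two characters.\<close>

definition entry_estimate :: "nat \<Rightarrow> (nat set \<Rightarrow> nat set \<Rightarrow> real) \<Rightarrow> nat \<Rightarrow> nat \<Rightarrow> real" where
  "entry_estimate m g i j =
     4 / 4 ^ m * (\<Sum>(A, B)\<in>Pow {..<m} \<times> Pow {..<m}. chi i A * chi j B * g A B)"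

text \<open>A cut query is bilinear in the indicators of \<open>A\<close> and \<open>B\<close>, so
  its coefficient at \<open>chi i A * chi j B\<close> factors and only the entry
  \<open>(i, j)\<close> survives. The factor 4 is one 2 from \<open>sum_chi_of_bool\<close> for each
  of the two sets.\<close>

lemma fourier_cut_query:
  fixes x :: "nat \<Rightarrow> nat \<Rightarrow> real"
  assumes "i < m" "j < m"
  shows "4 * (\<Sum>(A, B)\<in>Pow {..<m} \<times> Pow {..<m}. chi i A * chi j B * (\<Sum>l\<in>A. \<Sum>p\<in>B. x l p)) = 4 ^ m * x i j"
proof -
  define P where "P = Pow {..<m}"
  have q: "(\<Sum>l\<in>A. \<Sum>p\<in>B. x l p) = (\<Sum>l<m. \<Sum>p<m. x l p * (of_bool (l \<in> A) * of_bool (p \<in> B)))"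
    if "A \<in> P" "B \<in> P" for A B
  proof -
    have "(\<Sum>l\<in>A. \<Sum>p\<in>B. x l p) = (\<Sum>l\<in>A. \<Sum>p<m. x l p * of_bool (p \<in> B))"
      using that by (intro sum.cong refl sum.mono_neutral_cong_left) (auto simp: P_def)
    also have "\<dots> = (\<Sum>l<m. \<Sum>p<m. x l p * (of_bool (l \<in> A) * of_bool (p \<in> B)))"
      using that by (intro sum.mono_neutral_cong_left) (auto simp: P_def)
    finally show ?thesis .
  qed
  have "(\<Sum>(A, B)\<in>P \<times> P. chi i A * chi j B * (\<Sum>l\<in>A. \<Sum>p\<in>B. x l p))
      = (\<Sum>(A, B)\<in>P \<times> P. \<Sum>l<m. \<Sum>p<m. x l p * ((chi i A * of_bool (l \<in> A)) * (chi j B * of_bool (p \<in> B))))"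
    by (intro sum.cong refl, clarify, subst q) (simp_all add: sum_distrib_left mult_ac)
  also have "\<dots> = (\<Sum>l<m. \<Sum>p<m. \<Sum>(A, B)\<in>P \<times> P. x l p * ((chi i A * of_bool (l \<in> A)) * (chi j B * of_bool (p \<in> B))))"
    unfolding case_prod_beta by (subst sum.swap, intro sum.cong refl sum.swap)
  also have "\<dots> = (\<Sum>l<m. \<Sum>p<m. x l p * ((\<Sum>A\<in>P. chi i A * of_bool (l \<in> A)) * (\<Sum>B\<in>P. chi j B * of_bool (p \<in> B))))"
    by (intro sum.cong refl, subst sum_product) (simp add: sum_distrib_left sum.cartesian_product case_prod_beta)
  finally have "4 * (\<Sum>(A, B)\<in>P \<times> P. chi i A * chi j B * (\<Sum>l\<in>A. \<Sum>p\<in>B. x l p))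
      = (\<Sum>l<m. \<Sum>p<m. x l p * ((2 * (\<Sum>A\<in>P. chi i A * of_bool (l \<in> A))) * (2 * (\<Sum>B\<in>P. chi j B * of_bool (p \<in> B)))))"
    by (simp add: sum_distrib_left[of 4] mult_ac)
  also have "\<dots> = (\<Sum>l<m. \<Sum>p<m. if l = i \<and> p = j then 4 ^ m * x i j else 0)"
    unfolding P_def using assms
    by (intro sum.cong refl, subst (1 2) sum_chi_of_bool) (auto simp: power_mult_distrib[symmetric])
  also have "\<dots> = (\<Sum>l<m. if l = i then (\<Sum>p<m. if p = j then 4 ^ m * x i j else 0) else 0)"
    by (intro sum.cong refl) auto
  also have "\<dots> = 4 ^ m * x i j"
    using assms by simp
  finally show ?thesis by (simp add: P_def)
qed

text \<open>The errors of the entries are scaled Fourier coefficients of the error of the answers,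
  so Bessel bounds their total by 16 times the mean squared error over the \<open>4 ^ m\<close>
  queries. As there are \<open>m * m\<close> entries, query error o(m) yields an average squared
  entry error o(1).\<close>

lemma entry_estimate_error:
  fixes x :: "nat \<Rightarrow> nat \<Rightarrow> real"
  shows "(\<Sum>(i, j)\<in>{..<m} \<times> {..<m}. (entry_estimate m g i j - x i j)\<^sup>2)
    \<le> 16 / 4 ^ m * (\<Sum>(A, B)\<in>Pow {..<m} \<times> Pow {..<m}. (g A B - (\<Sum>l\<in>A. \<Sum>p\<in>B. x l p))\<^sup>2)"
proof -
  define P where "P = Pow {..<m}"
  define h where "h = (\<lambda>(A, B). g A B - (\<Sum>l\<in>A. \<Sum>p\<in>B. x l p))"
  define e :: "nat \<times> nat \<Rightarrow> nat set \<times> nat set \<Rightarrow> real"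
    where "e = (\<lambda>(i, j) (A, B). chi i A * chi j B)"
  define a where "a u = (\<Sum>w\<in>P \<times> P. e u w * h w)" for u :: "nat \<times> nat"
  have coeff: "entry_estimate m g i j - x i j = 4 / 4 ^ m * a (i, j)" if "i < m" "j < m" for i j
  proof -
    have "a (i, j) = (\<Sum>(A, B)\<in>P \<times> P. chi i A * chi j B * g A B)
        - (\<Sum>(A, B)\<in>P \<times> P. chi i A * chi j B * (\<Sum>l\<in>A. \<Sum>p\<in>B. x l p))"
      unfolding sum_subtractf[symmetric] a_def
      by (intro sum.cong) (auto simp: e_def h_def right_diff_distrib)
    then show ?thesis
      using fourier_cut_query[OF that, of x]
      by (simp add: entry_estimate_def P_def[symmetric] field_simps)
  qed
  have orth: "(\<Sum>w\<in>P \<times> P. e u w * e v w) = (if u = v then 4 ^ m else 0)"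
    if "u \<in> {..<m} \<times> {..<m}" "v \<in> {..<m} \<times> {..<m}" for u v
  proof -
    obtain i j i' j' where [simp]: "u = (i, j)" "v = (i', j')" by fastforce
    have "(\<Sum>w\<in>P \<times> P. e u w * e v w)
        = (\<Sum>A\<in>P. chi i A * chi i' A) * (\<Sum>B\<in>P. chi j B * chi j' B)"
      unfolding sum_product sum.cartesian_product by (intro sum.cong) (auto simp: e_def mult_ac)
    then show ?thesis
      using that by (auto simp: P_def sum_chi_mult power_mult_distrib[symmetric])
  qed
  have "(\<Sum>(i, j)\<in>{..<m} \<times> {..<m}. (entry_estimate m g i j - x i j)\<^sup>2)
      = (4 / 4 ^ m)\<^sup>2 * (\<Sum>u\<in>{..<m} \<times> {..<m}. (a u)\<^sup>2)"
    unfolding sum_distrib_left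
    by (intro sum.cong refl) (auto simp: coeff power_mult_distrib power_divide)
  also have "\<dots> \<le> (4 / 4 ^ m)\<^sup>2 * (4 ^ m * (\<Sum>w\<in>P \<times> P. (h w)\<^sup>2))"
    unfolding a_def by (intro mult_left_mono bessel_finite[OF _ _ orth]) auto
  also have "\<dots> = 16 / 4 ^ m * (\<Sum>w\<in>P \<times> P. (h w)\<^sup>2)"
    by (simp add: power2_eq_square field_simps)
  also have "(\<Sum>w\<in>P \<times> P. (h w)\<^sup>2) = (\<Sum>(A, B)\<in>P \<times> P. (g A B - (\<Sum>l\<in>A. \<Sum>p\<in>B. x l p))\<^sup>2)"
    by (intro sum.cong) (auto simp: h_def)
  finally show ?thesis by (simp add: P_def)
qed

section \<open>Counting the cliques\<close>

text \<open>A proper colouring of the graph; on \<open>vertices k n\<close> with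
  \<open>k \<ge> 3\<close> it takes only the \<open>k\<close> colours below
  \<open>k\<close>.\<close>

fun class_of :: "vtx \<Rightarrow> nat" where
  "class_of (U i) = 0"
| "class_of (Y i) = 1"
| "class_of (W p i) = p + 2"

lemma adj_imp_class_of_neq: "adj X mu up a b \<Longrightarrow> class_of a \<noteq> class_of b"
  by (cases a; cases b) auto

lemma finite_vertices [simp]: "finite (vertices k n)"
proof -
  have "vertices k n \<subseteq> U ` {..<n div 3} \<union> Y ` {..<n div 3}
      \<union> (\<lambda>(p, i). W p i) ` ({..<k - 2} \<times> {..<n div 3})"
    by (auto simp: vertices_def)
  then show ?thesis by (rule finite_subset) auto
qed

lemma vertices_simps [simp]:
  "U i \<in> vertices k n \<longleftrightarrow> i < n div 3"
  "Y i \<in> vertices k n \<longleftrightarrow> i < n div 3"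
  "W p i \<in> vertices k n \<longleftrightarrow> p < k - 2 \<and> i < n div 3"
  by (auto simp: vertices_def)

text \<open>The map \<open>F\<close> is a bijection from \<open>D \<times> G\<close> onto the
  cliques. Once \<open>X i j\<close>, \<open>mu i\<close> and \<open>up j\<close> hold, the choice
  of one node in each of the \<open>k - 2\<close> parts \<open>W p\<close> is completely free, which
  gives the power of \<open>n div 3\<close>.\<close>

lemma num_cliques_eq:
  assumes "k \<ge> 3"
  shows "num_cliques k n X mu up
    = (n div 3) ^ (k - 2) * card {(i, j). i < n div 3 \<and> j < n div 3 \<and> X i j \<and> mu i \<and> up j}"
proof -
  define m where "m = n div 3"
  define C where "C = {S. S \<subseteq> vertices k n \<and> card S = k \<and> (\<forall>a\<in>S. \<forall>b\<in>S. a \<noteq> b \<longrightarrow> adj X mu up a b)}"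
  define D where "D = {(i, j). i < m \<and> j < m \<and> X i j \<and> mu i \<and> up j}"
  \<comment> \<open>Extensional functions, so that a clique determines its choice function
    uniquely.\<close>
  define G where "G = {..<k - 2} \<rightarrow>\<^sub>E {..<m}"
  define F where "F = (\<lambda>((i, j), g). insert (U i) (insert (Y j) ((\<lambda>p. W p (g p)) ` {..<k - 2})))"
  have inj: "inj_on F (D \<times> G)"
  proof (rule inj_onI)
    fix u u' assume u: "u \<in> D \<times> G" "u' \<in> D \<times> G" and "F u = F u'"
    obtain i j g i' j' g' where [simp]: "u = ((i, j), g)" "u' = ((i', j'), g')"
      by (metis surj_pair)
    have g: "g \<in> G" "g' \<in> G" and eq: "F ((i, j), g) = F ((i', j'), g')"
      using u \<open>F u = F u'\<close> by auto
    have "U i \<in> F ((i', j'), g')" "Y j \<in> F ((i', j'), g')"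
      unfolding eq[symmetric] by (auto simp: F_def)
    then have "i = i'" "j = j'" by (auto simp: F_def)
    moreover have "g = g'"
    proof (rule PiE_ext)
      show "g \<in> {..<k - 2} \<rightarrow>\<^sub>E {..<m}" "g' \<in> {..<k - 2} \<rightarrow>\<^sub>E {..<m}"
        using g by (auto simp: G_def)
      fix p assume "p \<in> {..<k - 2}"
      then have "W p (g p) \<in> F ((i', j'), g')"
        unfolding eq[symmetric] by (auto simp: F_def)
      then show "g p = g' p" by (auto simp: F_def)
    qed
    ultimately show "u = u'" by simp
  qed
  have sub: "F ` (D \<times> G) \<subseteq> C"
  proof clarify
    fix i j g assume ij: "(i, j) \<in> D" and g: "g \<in> G"
    have "card ((\<lambda>p. W p (g p)) ` {..<k - 2}) = k - 2"
      by (subst card_image) (auto intro: inj_onI)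
    then have "card (F ((i, j), g)) = k"
      using \<open>k \<ge> 3\<close> unfolding F_def by (subst split) (auto simp: card_insert_if)
    then show "F ((i, j), g) \<in> C"
      using ij g by (auto simp: C_def D_def G_def F_def m_def Pi_iff PiE_iff)
  qed
  have sup: "C \<subseteq> F ` (D \<times> G)"
  proof
    fix S assume S: "S \<in> C"
    then have Sv: "S \<subseteq> vertices k n" and Sk: "card S = k"
      and clique: "\<And>a b. a \<in> S \<Longrightarrow> b \<in> S \<Longrightarrow> a \<noteq> b \<Longrightarrow> adj X mu up a b"
      by (auto simp: C_def)
    have injp: "inj_on class_of S"
      using clique adj_imp_class_of_neq by (metis inj_onI)
    have "class_of ` S \<subseteq> {..<k}"
      using Sv \<open>k \<ge> 3\<close> by (auto simp: vertices_def)
    \<comment> \<open>Injectivity and \<open>card S = k\<close> leave no colour out: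
      \<open>S\<close> has exactly one node in each part.\<close>
    then have img: "class_of ` S = {..<k}"
      using card_image[OF injp] Sk by (intro card_subset_eq) auto
    have "\<exists>v\<in>S. class_of v = t" if "t < k" for t
      using img that by (metis imageE lessThan_iff)
    then obtain e where e: "\<And>t. t < k \<Longrightarrow> e t \<in> S \<and> class_of (e t) = t"
      by metis
    have "\<exists>i. v = U i" if "class_of v = 0" for v using that by (cases v) auto
    then obtain i where i: "e 0 = U i" using e[of 0] \<open>k \<ge> 3\<close> by fastforce
    have "\<exists>i. v = Y i" if "class_of v = 1" for v using that by (cases v) auto
    then obtain j where j: "e 1 = Y j" using e[of 1] \<open>k \<ge> 3\<close> by fastforce
    have "\<exists>i. v = W p i" if "class_of v = p + 2" for v p using that by (cases v) auto
    then have "\<exists>i. e (p + 2) = W p i" if "p < k - 2" for p using e[of "p + 2"] that by simp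
    then obtain g0 where g0: "\<And>p. p < k - 2 \<Longrightarrow> e (p + 2) = W p (g0 p)" by metis
    define g where "g = restrict g0 {..<k - 2}"
    have g: "e (p + 2) = W p (g p)" if "p < k - 2" for p using g0[OF that] that by (simp add: g_def)
    have US: "U i \<in> S" and YS: "Y j \<in> S" using e[of 0] e[of 1] i j \<open>k \<ge> 3\<close> by auto
    have WS: "W p (g p) \<in> S" if "p < k - 2" for p using e[of "p + 2"] g[OF that] that by auto
    have "g \<in> G"
    proof -
      have "g p < m" if "p < k - 2" for p using WS[OF that] Sv by (auto simp: m_def)
      moreover have "g \<in> extensional {..<k - 2}" by (simp add: g_def)
      ultimately show ?thesis by (auto simp: G_def PiE_iff)
    qed
    moreover have "(i, j) \<in> D"
      \<comment> \<open>Since \<open>k \<ge> 3\<close>, the part \<open>W 0\<close> exists; its node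
        in \<open>S\<close> forces \<open>mu i\<close> and \<open>up j\<close>.\<close>
      using clique[OF US YS] clique[OF US WS[of 0]] clique[OF YS WS[of 0]] US YS Sv \<open>k \<ge> 3\<close>
      by (auto simp: D_def m_def)
    moreover have "S = F ((i, j), g)"
    proof
      show "F ((i, j), g) \<subseteq> S" using US YS WS by (auto simp: F_def)
      show "S \<subseteq> F ((i, j), g)"
      proof
        fix v assume v: "v \<in> S"
        then have t: "class_of v < k" using img by auto
        then have ve: "v = e (class_of v)" using e[OF t] injp v by (metis inj_onD)
        consider "class_of v = 0" | "class_of v = 1" | p where "class_of v = p + 2" "p < k - 2"
          using t by (cases v) auto
        then show "v \<in> F ((i, j), g)"
        proof cases
          case 3
          then have "v = W p (g p)" using ve g by metis
          then show ?thesis using 3 by (simp add: F_def)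
        qed (use ve i j in \<open>simp_all add: F_def\<close>)
      qed
    qed
    ultimately show "S \<in> F ` (D \<times> G)" by blast
  qed
  have "card C = card (F ` (D \<times> G))"
    using sub sup by (intro arg_cong[where f = card]) blast
  also have "\<dots> = card (D \<times> G)"
    using inj by (rule card_image)
  also have "\<dots> = m ^ (k - 2) * card D"
    by (simp add: card_cartesian_product G_def card_PiE)
  finally show ?thesis
    by (simp add: num_cliques_def C_def D_def m_def)
qed

lemma num_cliques_cut_query:
  assumes "k \<ge> 3" "A \<subseteq> {..<n div 3}" "B \<subseteq> {..<n div 3}"
  shows "real (num_cliques k n (\<lambda>i j. (i, j) \<in> Z) (\<lambda>i. i \<in> A) (\<lambda>j. j \<in> B))
    = real (n div 3) ^ (k - 2) * (\<Sum>i\<in>A. \<Sum>j\<in>B. of_bool ((i, j) \<in> Z))"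
proof -
  have fin: "finite A" "finite B"
    using assms finite_subset by blast+
  have "{(i, j). i < n div 3 \<and> j < n div 3 \<and> (i, j) \<in> Z \<and> i \<in> A \<and> j \<in> B} = (A \<times> B) \<inter> Z"
    using assms by auto
  moreover have "(\<Sum>i\<in>A. \<Sum>j\<in>B. of_bool ((i, j) \<in> Z)) = real (card ((A \<times> B) \<inter> Z))"
    unfolding sum.cartesian_product using fin by (simp add: case_prod_beta of_bool_def sum.If_cases)
  ultimately show ?thesis
    using assms by (simp add: num_cliques_eq)
qed

section \<open>Splitting adjacency vectors into query and matrix parts\<close>

text \<open>The part of an adjacency vector that is determined by the query (A, B), and the part that
  is determined by the matrix Z.\<close>

definition query_nbrs :: "nat \<Rightarrow> nat \<Rightarrow> nat set \<Rightarrow> nat set \<Rightarrow> vtx \<Rightarrow> vtx set" where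
  "query_nbrs k n A B = nbrs k n (\<lambda>_ _. False) (\<lambda>i. i \<in> A) (\<lambda>i. i \<in> B)"

definition matrix_nbrs :: "nat \<Rightarrow> nat \<Rightarrow> (nat \<times> nat) set \<Rightarrow> vtx \<Rightarrow> vtx set" where
  "matrix_nbrs k n Z = nbrs k n (\<lambda>i j. (i, j) \<in> Z) (\<lambda>_. False) (\<lambda>_. False)"

text \<open>Each edge depends on the matrix alone, on the query alone, or on neither; the fixed
  edges among the W-nodes occur in both parts.\<close>

lemma nbrs_split:
  "nbrs k n (\<lambda>i j. (i, j) \<in> Z) (\<lambda>i. i \<in> A) (\<lambda>i. i \<in> B) v = query_nbrs k n A B v \<union> matrix_nbrs k n Z v"
proof -
  have "adj (\<lambda>i j. (i, j) \<in> Z) (\<lambda>i. i \<in> A) (\<lambda>i. i \<in> B) v w \<longleftrightarrow>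
      adj (\<lambda>_ _. False) (\<lambda>i. i \<in> A) (\<lambda>i. i \<in> B) v w
      \<or> adj (\<lambda>i j. (i, j) \<in> Z) (\<lambda>_. False) (\<lambda>_. False) v w" for w
    by (cases v; cases w) auto
  then show ?thesis
    by (auto simp: query_nbrs_def matrix_nbrs_def nbrs_def)
qed

lemma matrix_nbrs_subset: "matrix_nbrs k n Z v \<subseteq> vertices k n"
  by (auto simp: matrix_nbrs_def nbrs_def)

lemma query_nbrs_subset: "query_nbrs k n A B v \<subseteq> vertices k n"
  by (auto simp: query_nbrs_def nbrs_def)

lemma mem_matrix_nbrs:
  "w \<in> matrix_nbrs k n Z (U i) \<longleftrightarrow> (\<exists>j. w = Y j \<and> j < n div 3 \<and> (i, j) \<in> Z)"
  "w \<in> matrix_nbrs k n Z (Y j) \<longleftrightarrow> (\<exists>i. w = U i \<and> i < n div 3 \<and> (i, j) \<in> Z)"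
  "w \<in> matrix_nbrs k n Z (W p l) \<longleftrightarrow> (\<exists>q l'. w = W q l' \<and> q < k - 2 \<and> l' < n div 3 \<and> p \<noteq> q)"
  by (cases w; auto simp: matrix_nbrs_def nbrs_def)+

text \<open>A node of U or Y is joined to all W-nodes or to none. Hence two reports of such a node
  cover all of the exponentially many queries.\<close>

lemma query_nbrs_cases:
  assumes "v = U i \<or> v = Y j"
  shows "query_nbrs k n A B v \<in> {{}, {w \<in> vertices k n. \<exists>p l. w = W p l}}"
proof -
  have "adj (\<lambda>_ _. False) (\<lambda>i. i \<in> A) (\<lambda>i. i \<in> B) (U i) w \<longleftrightarrow> i \<in> A \<and> (\<exists>p l. w = W p l)"
    "adj (\<lambda>_ _. False) (\<lambda>i. i \<in> A) (\<lambda>i. i \<in> B) (Y j) w \<longleftrightarrow> j \<in> B \<and> (\<exists>p l. w = W p l)" for w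
    by (cases w; auto)+
  with assms show ?thesis
    by (auto simp: query_nbrs_def nbrs_def)
qed

lemma matrix_nbrs_flip_other:
  assumes "v \<noteq> U i" "v \<noteq> Y j"
  shows "matrix_nbrs k n (sym_diff Z {(i, j)}) v = matrix_nbrs k n Z v"
  using assms by (cases v) (auto simp: set_eq_iff mem_matrix_nbrs)

text \<open>The set \<open>b\<close> contains only W-nodes, so it cannot mask the flipped bit, which
  concerns a node of U or Y.\<close>

lemma matrix_nbrs_flip:
  assumes v: "v = U i \<or> v = Y j" and b: "b \<in> {{}, {w \<in> vertices k n. \<exists>p l. w = W p l}}"
    and "i < n div 3" "j < n div 3"
  shows "card (sym_diff (b \<union> matrix_nbrs k n Z v) (b \<union> matrix_nbrs k n (sym_diff Z {(i, j)}) v)) = 1"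
proof -
  have disj: "U l \<notin> b" "Y l \<notin> b" for l using b by auto
  have "sym_diff (b \<union> matrix_nbrs k n Z v) (b \<union> matrix_nbrs k n (sym_diff Z {(i, j)}) v)
      = (if v = U i then {Y j} else {U i})"
    using v
  proof
    assume "v = U i"
    then show ?thesis
      using assms(3,4) disj by (auto simp: mem_matrix_nbrs)
  next
    assume "v = Y j"
    then show ?thesis
      using assms(3,4) disj by (auto simp: mem_matrix_nbrs)
  qed
  then show ?thesis by simp
qed

section \<open>The joint sample that answers all queries\<close>

locale noninteractive_protocol =
  fixes k n :: nat and eps :: real and Mo :: "'o measure"
    and R :: "vtx \<Rightarrow> vtx set \<Rightarrow> 'o measure" and f :: "(vtx \<Rightarrow> 'o) \<Rightarrow> real"
  assumes k: "k \<ge> 3" and eps: "eps \<ge> 0"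
    and ldp: "\<And>v. v \<in> vertices k n \<Longrightarrow> edge_ldp eps (vertices k n) Mo (R v)"
    and f: "f \<in> borel_measurable (PiM (vertices k n) (\<lambda>_. Mo))"
begin

abbreviation "m \<equiv> n div 3"
abbreviation "V \<equiv> vertices k n"
abbreviation "Q \<equiv> Pow {..<m} \<times> Pow {..<m}"

text \<open>Every node reports once for each value of the query-dependent part of its adjacency
  vector, so that one sample answers all queries (A, B). For the nodes of U and Y there
  are only two such values; for those of W the report does not depend on the matrix.\<close>

definition idx :: "(vtx \<times> vtx set) set" where
  "idx = (\<lambda>((A, B), v). (v, query_nbrs k n A B v)) ` (Q \<times> V)"

text \<open>The value outside of the index set is an arbitrary probability measure.\<close>

definition report :: "(nat \<times> nat) set \<Rightarrow> vtx \<times> vtx set \<Rightarrow> 'o measure" where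
  "report Z = (\<lambda>(v, b). if v \<in> V \<and> b \<subseteq> V then R v (b \<union> matrix_nbrs k n Z v)
      else return (count_space UNIV) undefined)"

definition view :: "nat set \<Rightarrow> nat set \<Rightarrow> (vtx \<times> vtx set \<Rightarrow> 'o) \<Rightarrow> vtx \<Rightarrow> 'o" where
  "view A B \<omega> = (\<lambda>v\<in>V. \<omega> (v, query_nbrs k n A B v))"

lemma finite_idx: "finite idx"
  by (simp add: idx_def)

lemma idxD: "(v, b) \<in> idx \<Longrightarrow> v \<in> V \<and> b \<subseteq> V"
  by (auto simp: idx_def dest: subsetD[OF query_nbrs_subset])

lemma R_prob:
  assumes "v \<in> V" "a \<subseteq> V"
  shows "prob_space (R v a)" "sets (R v a) = sets Mo"
  using ldp[OF assms(1)] assms(2) by (auto simp: edge_ldp_def)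

lemma report_prob: "prob_space (report Z u)"
  by (cases u)
    (auto simp: report_def intro!: R_prob prob_space_return dest: subsetD[OF matrix_nbrs_subset])

lemma report_sets: "u \<in> idx \<Longrightarrow> sets (report Z u) = sets Mo"
  using matrix_nbrs_subset[of k n Z "fst u"] idxD[of "fst u" "snd u"]
  by (auto simp: report_def intro!: R_prob split: prod.split)

lemma sets_PiM_report: "sets (PiM idx (report Z)) = sets (PiM idx (\<lambda>_. Mo))"
  by (intro sets_PiM_cong) (auto simp: report_sets)

lemma measurable_view: "view A B \<in> measurable (PiM idx (\<lambda>_. Mo)) (PiM V (\<lambda>_. Mo))"
  if "A \<subseteq> {..<m}" "B \<subseteq> {..<m}"
  unfolding view_def
proof (rule measurable_restrict)
  fix v assume "v \<in> V"
  then have "(v, query_nbrs k n A B v) \<in> idx"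
    using that by (force simp: idx_def)
  then show "(\<lambda>\<omega>. \<omega> (v, query_nbrs k n A B v)) \<in> measurable (PiM idx (\<lambda>_. Mo)) Mo"
    by (rule measurable_component_singleton)
qed

text \<open>For a fixed query, \<open>v\<close> is mapped injectively to a coordinate of the joint
  sample, and the marginal of a product measure on these coordinates is again the product. So
  \<open>view A B\<close> has exactly the law of the reports of the protocol. This uses that each
  report depends only on the node's own adjacency vector.\<close>

lemma mse_eq_view:
  assumes AB: "A \<subseteq> {..<m}" "B \<subseteq> {..<m}"
  shows "mse k n R f (\<lambda>i j. (i, j) \<in> Z) (\<lambda>i. i \<in> A) (\<lambda>i. i \<in> B)
    = (\<integral>\<^sup>+ \<omega>. ennreal ((f (view A B \<omega>)
        - real m ^ (k - 2) * (\<Sum>i\<in>A. \<Sum>j\<in>B. of_bool ((i, j) \<in> Z)))\<^sup>2) \<partial>PiM idx (report Z))"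
proof -
  let ?q = "\<lambda>v. (v, query_nbrs k n A B v)"
  let ?P = "PiM V (\<lambda>v. report Z (?q v))"
  have q: "?q v \<in> idx" if "v \<in> V" for v
    using that AB by (force simp: idx_def)
  have P: "PiM V (\<lambda>v. R v (nbrs k n (\<lambda>i j. (i, j) \<in> Z) (\<lambda>i. i \<in> A) (\<lambda>i. i \<in> B) v)) = ?P"
    by (intro PiM_cong) (auto simp: report_def nbrs_split subset_iff dest: subsetD[OF query_nbrs_subset])
  have sets: "sets ?P = sets (PiM V (\<lambda>_. Mo))"
    by (intro sets_PiM_cong refl report_sets q)
  have distr: "distr (PiM idx (report Z)) ?P (view A B) = ?P"
    unfolding view_def by (intro distr_PiM_reindex report_prob inj_onI) (auto intro: q)
  have view: "view A B \<in> measurable (PiM idx (report Z)) ?P"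
    using measurable_view[OF AB] by (simp cong: measurable_cong_sets add: sets sets_PiM_report)
  have "f \<in> borel_measurable ?P"
    using f by (simp cong: measurable_cong_sets add: sets)
  then have "(\<integral>\<^sup>+ r. ennreal ((f r - c)\<^sup>2) \<partial>?P)
      = (\<integral>\<^sup>+ \<omega>. ennreal ((f (view A B \<omega>) - c)\<^sup>2) \<partial>PiM idx (report Z))" for c
    by (subst distr[symmetric], subst nn_integral_distr[OF view]) auto
  then show ?thesis
    using AB k by (simp add: mse_def P num_cliques_cut_query)
qed

section \<open>Privacy of the joint sample\<close>

text \<open>An entry of the matrix is one bit in the vectors of its two endpoints and is invisible
  to all other nodes, whose reports keep the same law and get the factor 1.\<close>

lemma report_flip:
  assumes "u \<in> idx" "S \<in> sets Mo" "i < m" "j < m"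
  shows "emeasure (report Z u) S
    \<le> (if fst u \<in> {U i, Y j} then ennreal (exp eps) else 1) * emeasure (report (sym_diff Z {(i, j)}) u) S"
proof -
  obtain v b where u: "u = (v, b)" by fastforce
  note vb = idxD[OF assms(1)[unfolded u]]
  let ?a = "b \<union> matrix_nbrs k n Z v" and ?a' = "b \<union> matrix_nbrs k n (sym_diff Z {(i, j)}) v"
  have rep: "report Z u = R v ?a" "report (sym_diff Z {(i, j)}) u = R v ?a'"
    using vb by (auto simp: report_def u)
  have a: "?a \<subseteq> V" "?a' \<subseteq> V"
    using vb matrix_nbrs_subset by blast+
  interpret a: prob_space "R v ?a" using a vb by (intro R_prob) auto
  interpret a': prob_space "R v ?a'" using a vb by (intro R_prob) auto
  show ?thesis
  proof (cases "v \<in> {U i, Y j}")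
    case True
    obtain A B where "b = query_nbrs k n A B v"
      using assms(1) by (auto simp: idx_def u)
    then have "b \<in> {{}, {w \<in> V. \<exists>p l. w = W p l}}"
      using query_nbrs_cases[of v i j k n A B] True by simp
    then have "card (sym_diff ?a ?a') = 1"
      using True assms(3,4) by (intro matrix_nbrs_flip) auto
    then have "measure (R v ?a) S \<le> exp eps * measure (R v ?a') S"
      using ldp vb a assms(2) unfolding edge_ldp_def by blast
    then have "ennreal (measure (R v ?a) S) \<le> ennreal (exp eps) * ennreal (measure (R v ?a') S)"
      by (subst ennreal_mult[symmetric]) (auto intro: ennreal_leI)
    then show ?thesis
      unfolding rep using True by (simp add: u a.emeasure_eq_measure a'.emeasure_eq_measure)
  next
    case False
    then have "?a = ?a'"
      using matrix_nbrs_flip_other[of v i j k n Z] by auto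
    then show ?thesis
      unfolding rep using False by (simp add: u)
  qed
qed

text \<open>The exponent is 4: flipping the entry (i, j) affects only the two reports of
  the i-th node of U and the two reports of the j-th node of Y.\<close>

lemma nn_integral_report_flip:
  assumes ij: "i < m" "j < m" and phi: "\<phi> \<in> borel_measurable (PiM idx (\<lambda>_. Mo))"
  shows "nn_integral (PiM idx (report Z)) \<phi>
    \<le> ennreal (exp (4 * eps)) * nn_integral (PiM idx (report (sym_diff Z {(i, j)}))) \<phi>"
proof -
  let ?K = "\<lambda>u. if fst u \<in> {U i, Y j} then ennreal (exp eps) else 1" and ?Z' = "sym_diff Z {(i, j)}"
  let ?D = "{u \<in> idx. fst u \<in> {U i, Y j}}"
  have "?D \<subseteq> {U i, Y j} \<times> {{}, {w \<in> V. \<exists>p l. w = W p l}}"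
  proof
    fix u assume "u \<in> ?D"
    moreover from this obtain A B v where "u = (v, query_nbrs k n A B v)"
      by (auto simp: idx_def)
    ultimately show "u \<in> {U i, Y j} \<times> {{}, {w \<in> V. \<exists>p l. w = W p l}}"
      using query_nbrs_cases[of v i j k n A B] by simp blast
  qed
  then have "card ?D \<le> card ({U i, Y j} \<times> {{}, {w \<in> V. \<exists>p l. w = W p l}})"
    by (intro card_mono) auto
  also have "\<dots> \<le> 2 * 2"
    unfolding card_cartesian_product by (intro mult_mono) (auto simp: card_insert_if)
  finally have D: "card ?D \<le> 4" by simp
  have "nn_integral (PiM idx (report Z)) \<phi>
      \<le> (\<Prod>u\<in>idx. ?K u) * nn_integral (PiM idx (report ?Z')) \<phi>"
  proof (rule nn_integral_PiM_le_scaled)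
    show "\<phi> \<in> borel_measurable (PiM idx (report Z))"
      using phi by (simp cong: measurable_cong_sets add: sets_PiM_report)
  qed (use report_flip[OF _ _ ij] in \<open>simp_all add: finite_idx report_prob report_sets\<close>)
  \<comment> \<open>Only the coordinates in \<open>?D\<close> carry a factor different from the
    literal 1.\<close>
  also have "(\<Prod>u\<in>idx. ?K u) = ennreal (exp eps) ^ card ?D"
    using finite_idx by (subst prod.If_cases) (auto simp: Int_def)
  also have "\<dots> = ennreal (exp (card ?D * eps))"
    by (simp add: ennreal_power exp_of_nat_mult)
  also have "\<dots> \<le> ennreal (exp (4 * eps))"
    using D eps by (intro ennreal_leI) (auto intro!: mult_right_mono)
  finally show ?thesis by (simp add: mult_right_mono)
qed

section \<open>Lower bounds on the error\<close>

text \<open>Le Cam's two-point method: no value of \<open>T\<close> is close to both 0 and 1, while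
  privacy lets the error at the flipped matrix be measured under the law for \<open>Z\<close> at the
  cost of a factor \<open>exp (4 * eps)\<close>.\<close>

lemma entry_error_lower_bound:
  assumes ij: "i < m" "j < m" and T: "T \<in> borel_measurable (PiM idx (\<lambda>_. Mo))"
  defines "L \<equiv> \<lambda>Z. \<integral>\<^sup>+ \<omega>. ennreal ((T \<omega> - of_bool ((i, j) \<in> Z))\<^sup>2) \<partial>PiM idx (report Z)"
  shows "ennreal (exp (- 4 * eps) / 2) \<le> L Z + L (sym_diff Z {(i, j)})"
proof -
  let ?Z' = "sym_diff Z {(i, j)}" and ?P = "PiM idx (report Z)"
  let ?x = "of_bool ((i, j) \<in> Z) :: real" and ?y = "of_bool ((i, j) \<in> sym_diff Z {(i, j)}) :: real"
  interpret P: prob_space ?P by (intro prob_space_PiM report_prob)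
  have TP [measurable]: "T \<in> borel_measurable ?P"
    using T by (simp cong: measurable_cong_sets add: sets_PiM_report)
  \<comment> \<open>The two targets are 0 and 1 in some order; the minimum is attained midway, at
    \<open>t = 1 / 2\<close>.\<close>
  have "1 / 2 \<le> (t - ?x)\<^sup>2 + (t - ?y)\<^sup>2" for t :: real
  proof -
    have "?y = 1 - ?x" by auto
    then have "(t - ?x)\<^sup>2 + (t - ?y)\<^sup>2 = 1 / 2 + 2 * (t - 1 / 2)\<^sup>2"
      by (cases "(i, j) \<in> Z") (auto simp: power2_eq_square algebra_simps)
    then show ?thesis by simp
  qed
  then have "ennreal (1 / 2) \<le> ennreal ((t - ?x)\<^sup>2 + (t - ?y)\<^sup>2)" for t :: real
    by (rule ennreal_leI)
  then have "ennreal (1 / 2) \<le> ennreal ((t - ?x)\<^sup>2) + ennreal ((t - ?y)\<^sup>2)" for t :: real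
    by (subst ennreal_plus[symmetric]) (simp_all only: zero_le_power2)
  then have "(\<integral>\<^sup>+ \<omega>. ennreal (1 / 2) \<partial>?P) \<le> (\<integral>\<^sup>+ \<omega>. ennreal ((T \<omega> - ?x)\<^sup>2) + ennreal ((T \<omega> - ?y)\<^sup>2) \<partial>?P)"
    by (intro nn_integral_mono) auto
  also have "\<dots> = L Z + (\<integral>\<^sup>+ \<omega>. ennreal ((T \<omega> - ?y)\<^sup>2) \<partial>?P)"
    unfolding L_def by (rule nn_integral_add) auto
  also have "\<dots> \<le> ennreal (exp (4 * eps)) * L Z + ennreal (exp (4 * eps)) * L ?Z'"
  proof (rule add_mono)
    have "1 \<le> ennreal (exp (4 * eps))"
      using eps by (simp add: ennreal_1[symmetric] del: ennreal_1)
    then show "L Z \<le> ennreal (exp (4 * eps)) * L Z"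
      using mult_right_mono[of 1 "ennreal (exp (4 * eps))" "L Z"] by simp
    show "(\<integral>\<^sup>+ \<omega>. ennreal ((T \<omega> - ?y)\<^sup>2) \<partial>?P) \<le> ennreal (exp (4 * eps)) * L ?Z'"
      unfolding L_def using T by (intro nn_integral_report_flip ij) auto
  qed
  finally have "ennreal (1 / 2) \<le> ennreal (exp (4 * eps)) * (L Z + L ?Z')"
    by (simp add: P.emeasure_space_1 distrib_left)
  then have "ennreal (exp (- 4 * eps)) * ennreal (1 / 2)
      \<le> ennreal (exp (- 4 * eps)) * (ennreal (exp (4 * eps)) * (L Z + L ?Z'))"
    by (rule mult_left_mono) simp
  also have "\<dots> = L Z + L ?Z'"
    by (simp add: mult.assoc[symmetric] ennreal_mult[symmetric] exp_add[symmetric])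
  also have "ennreal (exp (- 4 * eps)) * ennreal (1 / 2) = ennreal (exp (- 4 * eps) / 2)"
    by (subst ennreal_mult[symmetric]) auto
  finally show ?thesis .
qed

text \<open>Double counting of \<open>L i j Z\<close> over all entries and all matrices. For each
  matrix, Bessel bounds the sum over the entries from above; for each entry, privacy bounds the sum
  over the matrices from below.\<close>

theorem mse_lower_bound:
  assumes m: "m > 0" and c: "c \<ge> 0"
    and mse: "\<And>X mu up. mse k n R f X mu up \<le> ennreal ((c * real m ^ (k - 1))\<^sup>2)"
  shows "exp (- 4 * eps) \<le> 64 * c\<^sup>2"
proof -
  \<comment> \<open>Dividing by the number of choices of W-nodes turns a clique estimate into a cut
    estimate, and error \<open>c * m ^ (k - 1)\<close> into \<open>c * m\<close>.\<close>
  define g where "g \<omega> A B = f (view A B \<omega>) / real m ^ (k - 2)" for \<omega> A B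
  define T where "T i j \<omega> = entry_estimate m (g \<omega>) i j" for i j \<omega>
  define L where "L i j Z = (\<integral>\<^sup>+ \<omega>. ennreal ((T i j \<omega> - of_bool ((i, j) \<in> Z))\<^sup>2) \<partial>PiM idx (report Z))" for i j Z
  define \<Z> where "\<Z> = Pow ({..<m} \<times> {..<m})"
  have view_f [measurable]: "(\<lambda>\<omega>. f (view A B \<omega>)) \<in> borel_measurable (PiM idx (\<lambda>_. Mo))"
    if "A \<subseteq> {..<m}" "B \<subseteq> {..<m}" for A B
    using measurable_compose[OF measurable_view[OF that] f] by simp
  have view_f_report: "(\<lambda>\<omega>. f (view A B \<omega>)) \<in> borel_measurable (PiM idx (report Z))"
    if "A \<subseteq> {..<m}" "B \<subseteq> {..<m}" for A B Z
    using view_f[OF that] by (simp cong: measurable_cong_sets add: sets_PiM_report)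
  have T: "T i j \<in> borel_measurable (PiM idx (\<lambda>_. Mo))" for i j
    unfolding T_def entry_estimate_def g_def case_prod_beta
    by (intro borel_measurable_times borel_measurable_sum borel_measurable_divide view_f) auto
  have T_report: "T i j \<in> borel_measurable (PiM idx (report Z))" for i j Z
    using T by (simp cong: measurable_cong_sets add: sets_PiM_report)

  have query: "(\<integral>\<^sup>+ \<omega>. ennreal ((g \<omega> A B - (\<Sum>i\<in>A. \<Sum>j\<in>B. of_bool ((i, j) \<in> Z)))\<^sup>2) \<partial>PiM idx (report Z))
      \<le> ennreal ((c * m)\<^sup>2)" if AB: "A \<subseteq> {..<m}" "B \<subseteq> {..<m}" for A B Z
  proof -
    let ?s = "(\<Sum>i\<in>A. \<Sum>j\<in>B. of_bool ((i, j) \<in> Z)) :: real" and ?M = "real m ^ (k - 2)"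
    have M: "?M > 0" using m by simp
    have "g \<omega> A B - ?s = 1 / ?M * (f (view A B \<omega>) - ?M * ?s)" for \<omega>
      using m by (simp add: g_def diff_divide_distrib)
    then have "(g \<omega> A B - ?s)\<^sup>2 = (1 / ?M)\<^sup>2 * (f (view A B \<omega>) - ?M * ?s)\<^sup>2" for \<omega>
      by (simp only: power_mult_distrib)
    then have "(\<integral>\<^sup>+ \<omega>. ennreal ((g \<omega> A B - ?s)\<^sup>2) \<partial>PiM idx (report Z))
        = (\<integral>\<^sup>+ \<omega>. ennreal ((1 / ?M)\<^sup>2) * ennreal ((f (view A B \<omega>) - ?M * ?s)\<^sup>2) \<partial>PiM idx (report Z))"
      by (simp add: ennreal_mult)
    also have "\<dots> = ennreal ((1 / ?M)\<^sup>2) * mse k n R f (\<lambda>i j. (i, j) \<in> Z) (\<lambda>i. i \<in> A) (\<lambda>i. i \<in> B)"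
      unfolding mse_eq_view[OF AB] using view_f_report[OF AB]
      by (intro nn_integral_cmult) auto
    also have "\<dots> \<le> ennreal ((1 / ?M)\<^sup>2) * ennreal ((c * real m ^ (k - 1))\<^sup>2)"
      using mse by (rule mult_left_mono) simp
    also have "\<dots> = ennreal ((1 / ?M * (c * real m ^ (k - 1)))\<^sup>2)"
      by (subst ennreal_mult[symmetric], simp, simp, simp only: power_mult_distrib)
    also have "real m ^ (k - 1) = ?M * m"
      using k by (simp add: power_Suc2[symmetric] Suc_diff_Suc numeral_2_eq_2 del: power_Suc)
    also have "1 / ?M * (c * (?M * m)) = c * m"
      using M by simp
    finally show ?thesis .
  qed

  have upper: "(\<Sum>(i, j)\<in>{..<m} \<times> {..<m}. L i j Z) \<le> ennreal (16 * (c * m)\<^sup>2)" for Z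
  proof -
    let ?h = "\<lambda>\<omega> (A, B). (g \<omega> A B - (\<Sum>i\<in>A. \<Sum>j\<in>B. of_bool ((i, j) \<in> Z)))\<^sup>2"
    have h0: "?h \<omega> q \<ge> 0" for \<omega> q by (cases q) simp
    have hm: "(\<lambda>\<omega>. ?h \<omega> q) \<in> borel_measurable (PiM idx (report Z))" if "q \<in> Q" for q
      using that view_f_report by (auto simp: g_def)
    have "(\<Sum>(i, j)\<in>{..<m} \<times> {..<m}. L i j Z)
        = (\<integral>\<^sup>+ \<omega>. (\<Sum>(i, j)\<in>{..<m} \<times> {..<m}. ennreal ((T i j \<omega> - of_bool ((i, j) \<in> Z))\<^sup>2)) \<partial>PiM idx (report Z))"
      unfolding L_def case_prod_beta using T_report by (subst nn_integral_sum) auto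
    also have "\<dots> = (\<integral>\<^sup>+ \<omega>. ennreal (\<Sum>(i, j)\<in>{..<m} \<times> {..<m}. (T i j \<omega> - of_bool ((i, j) \<in> Z))\<^sup>2) \<partial>PiM idx (report Z))"
      unfolding case_prod_beta by (subst sum_ennreal) auto
    \<comment> \<open>Bessel applies pointwise in the sample, because one \<open>\<omega>\<close>
      holds the answers to all queries.\<close>
    also have "\<dots> \<le> (\<integral>\<^sup>+ \<omega>. ennreal (16 / 4 ^ m * (\<Sum>q\<in>Q. ?h \<omega> q)) \<partial>PiM idx (report Z))"
      unfolding T_def by (intro nn_integral_mono ennreal_leI entry_estimate_error)
    also have "\<dots> = (\<integral>\<^sup>+ \<omega>. ennreal (16 / 4 ^ m) * (\<Sum>q\<in>Q. ennreal (?h \<omega> q)) \<partial>PiM idx (report Z))"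
      by (intro nn_integral_cong, subst sum_ennreal[OF h0], rule ennreal_mult, simp, rule sum_nonneg[OF h0])
    also have "\<dots> = ennreal (16 / 4 ^ m) * (\<integral>\<^sup>+ \<omega>. (\<Sum>q\<in>Q. ennreal (?h \<omega> q)) \<partial>PiM idx (report Z))"
      using hm by (intro nn_integral_cmult borel_measurable_sum measurable_compose[OF hm measurable_ennreal])
    also have "\<dots> = ennreal (16 / 4 ^ m) * (\<Sum>q\<in>Q. \<integral>\<^sup>+ \<omega>. ennreal (?h \<omega> q) \<partial>PiM idx (report Z))"
      by (subst nn_integral_sum, rule measurable_compose[OF hm measurable_ennreal], assumption, rule refl)
    also have "\<dots> \<le> ennreal (16 / 4 ^ m) * (\<Sum>q\<in>Q. ennreal ((c * m)\<^sup>2))"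
      using query by (intro mult_left_mono sum_mono) auto
    also have "(\<Sum>q\<in>Q. ennreal ((c * m)\<^sup>2)) = ennreal (4 ^ m * (c * m)\<^sup>2)"
      by (subst sum_ennreal)
        (simp_all add: card_cartesian_product card_Pow power_mult_distrib[symmetric])
    also have "ennreal (16 / 4 ^ m) * ennreal (4 ^ m * (c * m)\<^sup>2) = ennreal (16 * (c * m)\<^sup>2)"
      by (simp add: ennreal_mult[symmetric])
    finally show ?thesis .
  qed

  have fin: "finite \<Z>" and cardZ: "card \<Z> > 0"
    by (auto simp: \<Z>_def card_Pow)
  have lower: "ennreal (card \<Z> * (exp (- 4 * eps) / 2)) \<le> 2 * (\<Sum>Z\<in>\<Z>. L i j Z)" if "i < m" "j < m" for i j
  proof -
    have "ennreal (card \<Z> * (exp (- 4 * eps) / 2)) = (\<Sum>Z\<in>\<Z>. ennreal (exp (- 4 * eps) / 2))"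
      by (subst sum_ennreal) simp_all
    also have "\<dots> \<le> (\<Sum>Z\<in>\<Z>. L i j Z + L i j (sym_diff Z {(i, j)}))"
      unfolding L_def by (intro sum_mono entry_error_lower_bound that T)
    \<comment> \<open>Flipping the entry permutes the matrices, so both summands have the same
      total.\<close>
    also have "\<dots> = 2 * (\<Sum>Z\<in>\<Z>. L i j Z)"
      using that sum.reindex_bij_betw[OF bij_betw_flip[of "(i, j)" "{..<m} \<times> {..<m}"], of "L i j"]
      by (simp add: sum.distrib \<Z>_def mult_2)
    finally show ?thesis .
  qed
  have "ennreal (m * m * (card \<Z> * (exp (- 4 * eps) / 2)))
      = (\<Sum>(i, j)\<in>{..<m} \<times> {..<m}. ennreal (card \<Z> * (exp (- 4 * eps) / 2)))"
    unfolding case_prod_beta by (subst sum_ennreal) (simp_all add: card_cartesian_product)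
  also have "\<dots> \<le> (\<Sum>(i, j)\<in>{..<m} \<times> {..<m}. 2 * (\<Sum>Z\<in>\<Z>. L i j Z))"
    using lower by (intro sum_mono) auto
  also have "\<dots> = 2 * (\<Sum>Z\<in>\<Z>. \<Sum>(i, j)\<in>{..<m} \<times> {..<m}. L i j Z)"
    unfolding case_prod_beta sum_distrib_left by (rule sum.swap)
  also have "\<dots> \<le> 2 * (\<Sum>Z\<in>\<Z>. ennreal (16 * (c * m)\<^sup>2))"
    using upper by (intro mult_left_mono sum_mono) auto
  also have "\<dots> = ennreal (2 * (card \<Z> * (16 * (c * m)\<^sup>2)))"
    by (subst sum_ennreal) (simp_all add: ennreal_mult mult.left_commute[of _ 16])
  \<comment> \<open>Cancelling \<open>m * m * card \<Z>\<close> leaves the constant 64 as 2 * 2 *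
    16.\<close>
  finally have "m * m * (card \<Z> * (exp (- 4 * eps) / 2)) \<le> 2 * (card \<Z> * (16 * (c * m)\<^sup>2))"
    by (subst (asm) ennreal_le_iff) auto
  then have "(real m * real m * card \<Z>) * exp (- 4 * eps) \<le> (real m * real m * card \<Z>) * (64 * c\<^sup>2)"
    by (simp add: power2_eq_square algebra_simps)
  then show ?thesis
    using m cardZ by (subst (asm) mult_le_cancel_left_pos) auto
qed

end

section \<open>The asymptotic statement\<close>

text \<open>The o-notation is spelled out as a bound for every \<open>c > 0\<close> and all large
  \<open>n\<close>, uniform in \<open>X\<close>, \<open>mu\<close> and \<open>up\<close>. The lower
  bound is not asymptotic, so one suitable \<open>c\<close> and one large \<open>n\<close> give the
  contradiction.\<close>

theorem theorem2:
  fixes k :: nat and eps :: real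
    and Mo :: "nat \<Rightarrow> 'o measure"
    and R :: "nat \<Rightarrow> vtx \<Rightarrow> vtx set \<Rightarrow> 'o measure"
    and f :: "nat \<Rightarrow> (vtx \<Rightarrow> 'o) \<Rightarrow> real"
  assumes "k \<ge> 3" and "eps > 0"
  shows "\<not> ((\<forall>n. 3 dvd n \<longrightarrow>
               (\<forall>v \<in> vertices k n. edge_ldp eps (vertices k n) (Mo n) (R n v)) \<and>
               f n \<in> borel_measurable (PiM (vertices k n) (\<lambda>_. Mo n))) \<and>
            (\<forall>c > 0. \<forall>\<^sub>F n in sequentially. 3 dvd n \<longrightarrow>
               (\<forall>X mu up. mse k n (R n) (f n) X mu up
                   \<le> ennreal ((c * real (k * n div 3) ^ (k - 1))\<^sup>2))))"
proof (intro notI, elim conjE)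
  assume prot: "\<forall>n. 3 dvd n \<longrightarrow>
               (\<forall>v \<in> vertices k n. edge_ldp eps (vertices k n) (Mo n) (R n v)) \<and>
               f n \<in> borel_measurable (PiM (vertices k n) (\<lambda>_. Mo n))"
    and small: "\<forall>c > 0. \<forall>\<^sub>F n in sequentially. 3 dvd n \<longrightarrow>
               (\<forall>X mu up. mse k n (R n) (f n) X mu up
                   \<le> ennreal ((c * real (k * n div 3) ^ (k - 1))\<^sup>2))"
  \<comment> \<open>The power of \<open>k\<close> passes from the number of nodes
    \<open>k * m\<close> to \<open>m\<close>. With 16, the bound \<open>64 * c\<^sup>2\<close> of
    \<open>mse_lower_bound\<close> becomes \<open>exp (- 4 * eps) / 4\<close>, which is too
    small.\<close>
  define c where "c = exp (- 2 * eps) / (16 * real k ^ (k - 1))"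
  have "c > 0" using \<open>k \<ge> 3\<close> by (simp add: c_def)
  with small obtain N where N: "\<And>n X mu up. n \<ge> N \<Longrightarrow> 3 dvd n \<Longrightarrow>
      mse k n (R n) (f n) X mu up \<le> ennreal ((c * real (k * n div 3) ^ (k - 1))\<^sup>2)"
    unfolding eventually_sequentially by meson
  \<comment> \<open>A multiple of 3 beyond \<open>N\<close>; the added 1 ensures
    \<open>m > 0\<close>.\<close>
  define n where "n = 3 * (N + 1)"
  interpret noninteractive_protocol k n eps "Mo n" "R n" "f n"
    using prot assms by unfold_locales (auto simp: n_def)
  have "k * n div 3 = k * m"
    by (rule div_mult_swap[symmetric]) (simp add: n_def)
  then have eq: "c * real (k * n div 3) ^ (k - 1) = exp (- 2 * eps) / 16 * real m ^ (k - 1)"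
    using \<open>k \<ge> 3\<close> by (simp add: c_def power_mult_distrib)
  have "mse k n (R n) (f n) X mu up \<le> ennreal ((exp (- 2 * eps) / 16 * real m ^ (k - 1))\<^sup>2)" for X mu up
    unfolding eq[symmetric] by (rule N) (auto simp: n_def)
  then have "exp (- 4 * eps) \<le> 64 * (exp (- 2 * eps) / 16)\<^sup>2"
    by (intro mse_lower_bound) (auto simp: n_def)
  also have "\<dots> = exp (- 4 * eps) / 4"
    by (simp add: power2_eq_square exp_add[symmetric])
  finally show False by simp
qed

end
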